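(* Let $e=(\mathbf{e}_1,\dots,\mathbf{e}_u)$ and $f=(\mathbf{f}_1,\dots,\mathbf{f}_v)$ be disjoint tuples of vectors in $\mathbb{N}^d$ such that $\mathcal{Q}_{e,f}(\mathbf{n})\in\mathbb{Z}$ for all $\mathbf{n}\in\mathbb{N}^d$. Then: (1) If $|e|=|f|$ and $\Delta_{e,f}(\mathbf{x})\ge1$ for all $\mathbf{x}\in\mathcal{D}_{e,f}$, then $\mathcal{Q}_{e,f}$ satisfies the $p$-Lucas property for every prime $p$. (2) If $|e|\ne|f|$, or if there exists $\mathbf{x}\in\mathcal{D}_{e,f}$ with $\Delta_{e,f}(\mathbf{x})=0$, then there are only finitely many primes $p$ for which $\mathcal{Q}_{e,f}$ satisfies the $p$-Lucas property. Moreover, if $\mathcal{Q}_{e,f}$ satisfies the $p$-Lucas property for all primes $p$, then for every prime $p$ and every $\mathbf{n}\in\mathbb{N}^d$, $\mathcal{Q}_{e,f}(\mathbf{n})\in p^{\alpha_p(\mathcal{Q}_{e,f},\mathbf{n})}\mathbb{Z}$.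
   Context: "Disjoint" means no vector occurs both as a component of $e$ and of $f$. $|e|=\sum_i\mathbf{e}_i$, $|f|=\sum_i\mathbf{f}_i$. $\mathcal{Q}_{e,f}(\mathbf{n})=\prod_{i=1}^u(\mathbf{e}_i\cdot\mathbf{n})!/\prod_{i=1}^v(\mathbf{f}_i\cdot\mathbf{n})!$. $\Delta_{e,f}(\mathbf{x})=\sum_{i=1}^u\lfloor\mathbf{e}_i\cdot\mathbf{x}\rfloor-\sum_{i=1}^v\lfloor\mathbf{f}_i\cdot\mathbf{x}\rfloor$ for $\mathbf{x}\in\mathbb{R}^d$. $\mathcal{D}_{e,f}$ is the set of $\mathbf{x}\in[0,1)^d$ such that $\mathbf{d}\cdot\mathbf{x}\ge1$ for some component $\mathbf{d}$ of $e$ or of $f$. A family $A:\mathbb{N}^d\to\mathbb{Z}_p$ satisfies the $p$-Lucas property if $A(\mathbf{v}+\mathbf{n}p)\equiv A(\mathbf{v})A(\mathbf{n})\pmod{p\mathbb{Z}_p}$ for all $\mathbf{v}\in\{0,\dots,p-1\}^d$ and $\mathbf{n}\in\mathbb{N}^d$. $\mathcal{Z}_p(A)$ is the set of $\mathbf{v}\in\{0,\dots,p-1\}^d$ with $A(\mathbf{v})\in p\mathbb{Z}_p$; for $\mathbf{n}=\sum_{k=0}^N\mathbf{n}_kp^k$ with $\mathbf{n}_k\in\{0,\dots,p-1\}^d$ and $\mathbf{n}_N\ne\mathbf{0}$ (for $\mathbf{n}=\mathbf{0}$ the single digit $\mathbf{0}$), $\alpha_p(A,\mathbf{n})$ is the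 number of $k\in\{0,\dots,N\}$ with $\mathbf{n}_k\in\mathcal{Z}_p(A)$. *)

theory Defs
  imports "HOL-Analysis.Analysis" "HOL-Algebra.IntRing" "HOL-Computational_Algebra.Primes"
begin

section \<open>The ring of \<open>p\<close>-adic integers\<close>

text \<open>
  The inverse limit of the rings of integers modulo \<open>p ^ k\<close>: an element is a coherent sequence
  of canonical representatives, \<open>a k\<close> being the residue modulo \<open>p ^ k\<close>.
\<close>

definition padic_ints :: "nat \<Rightarrow> (nat \<Rightarrow> int) ring" where
  "padic_ints p =
     \<lparr>carrier = {a. \<forall>k. 0 \<le> a k \<and> a k < int p ^ k \<and> a (Suc k) mod int p ^ k = a k},
      mult = (\<lambda>a b k. a k * b k mod int p ^ k),
      one = (\<lambda>k. 1 mod int p ^ k),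
      zero = (\<lambda>k. 0),
      add = (\<lambda>a b k. (a k + b k) mod int p ^ k)\<rparr>"

definition padic_of_int :: "nat \<Rightarrow> int \<Rightarrow> (nat \<Rightarrow> int)" where
  "padic_of_int p m = (\<lambda>k. m mod int p ^ k)"

definition padic_max_ideal :: "nat \<Rightarrow> (nat \<Rightarrow> int) set" where
  "padic_max_ideal p = PIdl\<^bsub>padic_ints p\<^esub> (padic_of_int p (int p))"

lemma padic_of_int_closed:
  assumes "p > 0"
  shows "padic_of_int p m \<in> carrier (padic_ints p)"
  using assms by (auto simp: padic_of_int_def padic_ints_def mod_mod_cancel)

lemma padic_ints_mod_reduce:
  assumes "a \<in> carrier (padic_ints p)"
  shows "a (Suc k) mod int p ^ k = a k" "a k mod int p ^ k = a k"
  using assms by (auto simp: padic_ints_def)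

lemma padic_ints_cring:
  assumes p: "p > 0"
  shows "cring (padic_ints p)"
proof (rule cringI)
  show "abelian_group (padic_ints p)"
  proof (rule abelian_groupI)
    fix x y assume x: "x \<in> carrier (padic_ints p)" and y: "y \<in> carrier (padic_ints p)"
    have "(x (Suc k) + y (Suc k)) mod int p ^ Suc k mod int p ^ k = (x k + y k) mod int p ^ k" for k
    proof -
      have "(x (Suc k) + y (Suc k)) mod int p ^ Suc k mod int p ^ k
              = (x (Suc k) mod int p ^ k + y (Suc k) mod int p ^ k) mod int p ^ k"
        by (simp add: mod_mod_cancel mod_add_eq)
      then show ?thesis by (simp only: padic_ints_mod_reduce[OF x] padic_ints_mod_reduce[OF y])
    qed
    then show "x \<oplus>\<^bsub>padic_ints p\<^esub> y \<in> carrier (padic_ints p)"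
      using p by (auto simp: padic_ints_def)
  next
    fix x assume x: "x \<in> carrier (padic_ints p)"
    let ?y = "\<lambda>k. (- x k) mod int p ^ k"
    have "(- x (Suc k)) mod int p ^ Suc k mod int p ^ k = (- x k) mod int p ^ k" for k
    proof -
      have "(- x (Suc k)) mod int p ^ Suc k mod int p ^ k
              = (- (x (Suc k) mod int p ^ k)) mod int p ^ k"
        by (simp add: mod_mod_cancel mod_minus_eq)
      then show ?thesis by (simp only: padic_ints_mod_reduce[OF x])
    qed
    then have "?y \<in> carrier (padic_ints p)"
      using p by (auto simp: padic_ints_def)
    moreover have "?y \<oplus>\<^bsub>padic_ints p\<^esub> x = \<zero>\<^bsub>padic_ints p\<^esub>"
      by (auto simp: padic_ints_def mod_simps)
    ultimately show "\<exists>y\<in>carrier (padic_ints p). y \<oplus>\<^bsub>padic_ints p\<^esub> x = \<zero>\<^bsub>padic_ints p\<^esub>"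
      by blast
  qed (use p in \<open>auto simp: padic_ints_def mod_simps ac_simps\<close>)
next
  show "Group.comm_monoid (padic_ints p)"
  proof (rule comm_monoidI)
    fix x y assume x: "x \<in> carrier (padic_ints p)" and y: "y \<in> carrier (padic_ints p)"
    have "(x (Suc k) * y (Suc k)) mod int p ^ Suc k mod int p ^ k = (x k * y k) mod int p ^ k" for k
    proof -
      have "(x (Suc k) * y (Suc k)) mod int p ^ Suc k mod int p ^ k
              = ((x (Suc k) mod int p ^ k) * (y (Suc k) mod int p ^ k)) mod int p ^ k"
        by (simp add: mod_mod_cancel mod_mult_eq)
      then show ?thesis by (simp only: padic_ints_mod_reduce[OF x] padic_ints_mod_reduce[OF y])
    qed
    then show "x \<otimes>\<^bsub>padic_ints p\<^esub> y \<in> carrier (padic_ints p)"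
      using p by (auto simp: padic_ints_def)
  next
    show "\<one>\<^bsub>padic_ints p\<^esub> \<in> carrier (padic_ints p)"
      using padic_of_int_closed[OF p, of 1] by (simp add: padic_of_int_def padic_ints_def)
  qed (use p in \<open>auto simp: padic_ints_def mod_simps ac_simps\<close>)
next
  fix x y z
  show "(x \<oplus>\<^bsub>padic_ints p\<^esub> y) \<otimes>\<^bsub>padic_ints p\<^esub> z
          = x \<otimes>\<^bsub>padic_ints p\<^esub> z \<oplus>\<^bsub>padic_ints p\<^esub> y \<otimes>\<^bsub>padic_ints p\<^esub> z"
    by (auto simp: padic_ints_def mod_simps algebra_simps)
qed

lemma padic_of_int_hom:
  assumes "p > 0"
  shows "padic_of_int p \<in> ring_hom \<Z> (padic_ints p)"
  using padic_of_int_closed[OF assms]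
  by (intro ring_hom_memI) (auto simp: padic_ints_def padic_of_int_def mod_simps)

lemma padic_of_int_mem_max_ideal_iff:
  assumes "p > 0"
  shows "padic_of_int p m \<in> padic_max_ideal p \<longleftrightarrow> int p dvd m"
proof
  assume "padic_of_int p m \<in> padic_max_ideal p"
  then obtain z where "padic_of_int p m = z \<otimes>\<^bsub>padic_ints p\<^esub> padic_of_int p (int p)"
    by (auto simp: padic_max_ideal_def cgenideal_def)
  then have "padic_of_int p m 1 = (z \<otimes>\<^bsub>padic_ints p\<^esub> padic_of_int p (int p)) 1"
    by simp
  then show "int p dvd m"
    by (simp add: padic_of_int_def padic_ints_def mod_eq_0_iff_dvd)
next
  assume "int p dvd m"
  then obtain l where "m = l * int p" by (metis dvd_div_mult_self)
  then have "padic_of_int p m = padic_of_int p l \<otimes>\<^bsub>padic_ints p\<^esub> padic_of_int p (int p)"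
    by (auto simp: padic_of_int_def padic_ints_def mod_simps)
  then show "padic_of_int p m \<in> padic_max_ideal p"
    using padic_of_int_closed[OF assms] by (auto simp: padic_max_ideal_def cgenideal_def)
qed


section \<open>Families of \<open>p\<close>-adic integers\<close>

definition digit_vectors :: "nat \<Rightarrow> (nat ^ 'd) set" where
  "digit_vectors p = {v. \<forall>i. v $ i < p}"

definition p_Lucas :: "nat \<Rightarrow> (nat ^ 'd \<Rightarrow> (nat \<Rightarrow> int)) \<Rightarrow> bool" where
  "p_Lucas p A \<longleftrightarrow>
     (\<forall>v\<in>digit_vectors p. \<forall>n.
        A (v + p *s n) \<ominus>\<^bsub>padic_ints p\<^esub> A v \<otimes>\<^bsub>padic_ints p\<^esub> A n \<in> padic_max_ideal p)"

definition zero_digits :: "nat \<Rightarrow> (nat ^ 'd \<Rightarrow> (nat \<Rightarrow> int)) \<Rightarrow> (nat ^ 'd) set" where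
  "zero_digits p A = {v \<in> digit_vectors p. A v \<in> padic_max_ideal p}"

definition digit :: "nat \<Rightarrow> nat ^ 'd \<Rightarrow> nat \<Rightarrow> nat ^ 'd" where
  "digit p n k = (\<chi> i. n $ i div p ^ k mod p)"

text \<open>
  Leading zero digits must not be counted, since \<open>A 0\<close> may itself lie in the maximal ideal.
\<close>

definition top_index :: "nat \<Rightarrow> nat ^ 'd \<Rightarrow> nat" where
  "top_index p n = (if n = 0 then 0 else Max {k. digit p n k \<noteq> 0})"

lemma sum_digits:
  fixes n :: "nat ^ 'd"
  assumes p: "p \<ge> 2"
  shows "n = (\<Sum>k\<le>top_index p n. p ^ k *s digit p n k)"
proof -
  have expand: "m = (\<Sum>k<N. p ^ k * (m div p ^ k mod p)) + p ^ N * (m div p ^ N)" for m N :: nat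
  proof (induction N)
    case (Suc N)
    have "m div p ^ N = m div p ^ N mod p + p * (m div p ^ Suc N)"
      by (metis div_mult2_eq mod_mult_div_eq power_Suc2)
    then have "p ^ N * (m div p ^ N) = p ^ N * (m div p ^ N mod p) + p ^ Suc N * (m div p ^ Suc N)"
      by (metis distrib_left mult.assoc power_Suc2)
    with Suc show ?case by simp
  qed simp
  have bound: "n $ i < p ^ k" if "k \<ge> (\<Sum>i\<in>UNIV. n $ i)" for i k
  proof -
    have "n $ i \<le> (\<Sum>i\<in>UNIV. n $ i)" by (rule member_le_sum) auto
    also have "\<dots> \<le> k" by (fact that)
    also have "k < 2 ^ k" by (rule less_exp)
    also have "2 ^ k \<le> p ^ k" using p by (rule power_mono) simp
    finally show ?thesis .
  qed
  let ?S = "{k. digit p n k \<noteq> 0}" and ?B = "\<Sum>i\<in>UNIV. n $ i"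
  have "?S \<subseteq> {..<?B}"
  proof
    fix k assume k: "k \<in> ?S"
    show "k \<in> {..<?B}"
    proof (rule ccontr)
      assume "k \<notin> {..<?B}"
      then have "digit p n k = 0" using bound[of k] by (simp add: digit_def vec_eq_iff)
      with k show False by simp
    qed
  qed
  then have fin: "finite ?S" by (rule finite_subset) simp
  have zero: "digit p n k = 0" if "k > top_index p n" for k
  proof (cases "n = 0")
    case True then show ?thesis by (simp add: digit_def vec_eq_iff)
  next
    case False
    with that have "k > Max ?S" by (simp add: top_index_def)
    with Max_ge[OF fin, of k] have "k \<notin> ?S" by linarith
    then show ?thesis by simp
  qed
  have "n $ i = (\<Sum>k\<le>top_index p n. p ^ k *s digit p n k) $ i" for i
  proof -
    let ?M = "max ?B (Suc (top_index p n))"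
    have "n $ i = (\<Sum>k<?M. p ^ k * (n $ i div p ^ k mod p))"
      using expand[of "n $ i" ?M] bound[of ?M i] by simp
    also have "\<dots> = (\<Sum>k\<le>top_index p n. p ^ k * (n $ i div p ^ k mod p))"
    proof (rule sum.mono_neutral_right)
      show "\<forall>k\<in>{..<?M} - {..top_index p n}. p ^ k * (n $ i div p ^ k mod p) = 0"
        using zero by (auto simp: digit_def vec_eq_iff)
    qed auto
    finally show ?thesis by (simp add: digit_def)
  qed
  then show ?thesis by (simp add: vec_eq_iff)
qed

definition alpha :: "nat \<Rightarrow> (nat ^ 'd \<Rightarrow> (nat \<Rightarrow> int)) \<Rightarrow> nat ^ 'd \<Rightarrow> nat" where
  "alpha p A n = card {k \<in> {0..top_index p n}. digit p n k \<in> zero_digits p A}"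


section \<open>Factorial ratios\<close>

definition dot :: "nat ^ 'd \<Rightarrow> 'a::semiring_1 ^ 'd \<Rightarrow> 'a" where
  "dot a x = (\<Sum>i\<in>UNIV. of_nat (a $ i) * x $ i)"

definition factorial_ratio :: "(nat ^ 'd) list \<Rightarrow> (nat ^ 'd) list \<Rightarrow> nat ^ 'd \<Rightarrow> rat" where
  "factorial_ratio e f n = (\<Prod>a\<leftarrow>e. fact (dot a n)) / (\<Prod>a\<leftarrow>f. fact (dot a n))"

definition Delta :: "(nat ^ 'd) list \<Rightarrow> (nat ^ 'd) list \<Rightarrow> real ^ 'd \<Rightarrow> int" where
  "Delta e f x = (\<Sum>a\<leftarrow>e. \<lfloor>dot a x\<rfloor>) - (\<Sum>a\<leftarrow>f. \<lfloor>dot a x\<rfloor>)"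

definition jump_region :: "(nat ^ 'd) list \<Rightarrow> (nat ^ 'd) list \<Rightarrow> (real ^ 'd) set" where
  "jump_region e f = {x. (\<forall>i. 0 \<le> x $ i \<and> x $ i < 1) \<and> (\<exists>a\<in>set e \<union> set f. dot a x \<ge> 1)}"

text \<open>
  \<open>factorial_ratio e f\<close> as a family of \<open>p\<close>-adic integers. Only meaningful when \<open>factorial_ratio e f\<close> takes integer values,
  in which case taking the floor changes nothing.
\<close>

definition factorial_ratio_padic :: "nat \<Rightarrow> (nat ^ 'd) list \<Rightarrow> (nat ^ 'd) list \<Rightarrow> nat ^ 'd \<Rightarrow> (nat \<Rightarrow> int)" where
  "factorial_ratio_padic p e f n = padic_of_int p \<lfloor>factorial_ratio e f n\<rfloor>"

end

theory Submission
  imports Defs "HOL-Number_Theory.Cong"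
begin

text \<open>
  For a prime \<open>p\<close>, \<open>m!\<close> is \<open>p ^ (m div p) * (m div p)!\<close> times a unit congruent to
  \<open>(p - 1)! ^ (m div p) * (m mod p)!\<close>. Applied to every factor of the ratio \<open>Q\<close> at \<open>v + p n\<close> this gives
  the Lucas congruence when \<open>v / p\<close> lies outside the jump region; inside it both sides vanish modulo \<open>p\<close>,
  since by Legendre's formula the \<open>p\<close>-adic valuation of \<open>Q n\<close> is the sum of \<open>Delta (n / p ^ l)\<close> over \<open>l \<ge> 1\<close>.
  The same formula yields the divisibility by \<open>p ^ alpha\<close>: each digit counted by \<open>alpha\<close> pushes
  the fractional part of some \<open>n / p ^ l\<close> into the jump region.

  Conversely, if \<open>e\<close> and \<open>f\<close> have different sums, then \<open>p\<close> divides \<open>Q (p n)\<close> but not \<open>Q n\<close> for a suitable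
  unit vector \<open>n\<close> and all large \<open>p\<close>. If the sums agree and \<open>Delta x = 0\<close> at some \<open>x\<close> in the jump region,
  then approximating \<open>x\<close> by \<open>v / p\<close> in the Lucas congruences for infinitely many \<open>p\<close> yields the identity,
  valid for all \<open>n\<close>, between the products over \<open>e\<close> and over \<open>f\<close> of the binomial coefficients
  of \<open>m a + a \<cdot> n\<close> over \<open>m a\<close>, where \<open>m a = \<lfloor>a \<cdot> x\<rfloor>\<close>. Along a generic line \<open>n = t w\<close> both sides are
  polynomials in \<open>t\<close>, and comparing their roots contradicts disjointness.
\<close>

section \<open>Factorials modulo a prime\<close>

definition prod_fact :: "nat list \<Rightarrow> nat" where
  "prod_fact xs = (\<Prod>x\<leftarrow>xs. fact x)"

lemma prod_fact_simps [simp]: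
  "prod_fact [] = 1" "prod_fact (x # xs) = fact x * prod_fact xs"
  by (simp_all add: prod_fact_def)

lemma prod_fact_pos [simp]: "prod_fact xs > 0"
  by (induction xs) auto

text \<open>Extracting \<open>fact (k a)\<close> leaves a rising factorial with \<open>m a\<close>
  factors, which for fixed \<open>m a\<close> is a polynomial in \<open>k a\<close>. This later
  turns factorial identities into polynomial ones.\<close>

lemma prod_fact_add:
  "prod_fact (map (\<lambda>a. m a + k a) xs) = prod_fact (map k xs) * (\<Prod>a\<leftarrow>xs. pochhammer (k a + 1) (m a))"
proof (induction xs)
  case (Cons a xs)
  have "fact (m a + k a) = (fact (k a) * pochhammer (k a + 1) (m a) :: nat)"
    using pochhammer_product'[of "1 :: nat" "k a" "m a"] by (simp add: pochhammer_fact add.commute)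
  with Cons show ?case by (simp add: ac_simps)
qed auto

lemma prime_dvd_prod_fact_iff:
  assumes "prime p"
  shows "p dvd prod_fact xs \<longleftrightarrow> (\<exists>x\<in>set xs. p \<le> x)"
  using assms by (induction xs) (auto simp: prime_dvd_mult_iff prime_dvd_fact_iff)

text \<open>Sort the factors of \<open>m!\<close>: the multiples of \<open>p\<close> give
  \<open>p ^ (m div p) * (m div p)!\<close>, while the others, reduced modulo \<open>p\<close>, form
  \<open>m div p\<close> full runs \<open>1, ..., p - 1\<close> and one partial run.\<close>

lemma fact_div_mod:
  fixes p m :: nat
  assumes p: "p > 0"
  obtains w where "fact m = p ^ (m div p) * fact (m div p) * w"
    and "[w = fact (p - 1) ^ (m div p) * fact (m mod p)] (mod p)"
proof -
  have "\<exists>w. fact m = p ^ (m div p) * fact (m div p) * w \<and>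
      [w = fact (p - 1) ^ (m div p) * fact (m mod p)] (mod p)"
  proof (induction m)
    case 0
    then show ?case by auto
  next
    case (Suc m)
    then obtain w where w: "fact m = p ^ (m div p) * fact (m div p) * w"
      "[w = fact (p - 1) ^ (m div p) * fact (m mod p)] (mod p)"
      by blast
    show ?case
    proof (cases "Suc m mod p = 0")
      case True
      have d: "Suc m div p = Suc (m div p)"
        using True by (simp add: div_Suc)
      \<comment> \<open>The partial run is complete, so \<open>w\<close> stays the same and
        \<open>fact (m mod p)\<close> is counted as one more \<open>fact (p - 1)\<close>.\<close>
      have r: "m mod p = p - 1"
        using True p by (auto simp: mod_Suc split: if_splits)
      have "Suc m = p * Suc (m div p)"
        using True d by (metis add.right_neutral mult_div_mod_eq)
      then have "fact (Suc m) = p * Suc (m div p) * fact m"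
        by (metis fact_Suc of_nat_id)
      then have "fact (Suc m) = p ^ (Suc m div p) * fact (Suc m div p) * w"
        by (simp only: w(1) d fact_Suc power_Suc of_nat_id ac_simps)
      moreover have "[w = fact (p - 1) ^ (Suc m div p) * fact (Suc m mod p)] (mod p)"
        using w(2) True by (simp add: d r mult.commute)
      ultimately show ?thesis by blast
    next
      case False
      then have d: "Suc m div p = m div p"
        by (simp add: div_Suc)
      have r: "Suc m mod p = Suc (m mod p)"
        using False by (auto simp: mod_Suc split: if_splits)
      have "fact (Suc m) = p ^ (Suc m div p) * fact (Suc m div p) * (w * Suc m)"
        by (simp only: fact_Suc w(1) d of_nat_id ac_simps)
      moreover have "[w * Suc m = fact (p - 1) ^ (m div p) * fact (m mod p) * Suc (m mod p)] (mod p)"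
        by (rule cong_mult[OF w(2)]) (simp add: cong_def mod_Suc_eq)
      then have "[w * Suc m = fact (p - 1) ^ (Suc m div p) * fact (Suc m mod p)] (mod p)"
        by (simp only: d r fact_Suc of_nat_id ac_simps)
      ultimately show ?thesis by blast
    qed
  qed
  then show thesis using that by blast
qed

lemma prod_fact_div_mod:
  fixes p :: nat
  assumes p: "prime p"
  obtains w where
    "prod_fact xs = p ^ (\<Sum>x\<leftarrow>xs. x div p) * prod_fact (map (\<lambda>x. x div p) xs) * w"
    and "[w = fact (p - 1) ^ (\<Sum>x\<leftarrow>xs. x div p) * prod_fact (map (\<lambda>x. x mod p) xs)] (mod p)"
    and "\<not> p dvd w"
proof -
  have p0: "p > 0" using p by (rule prime_gt_0_nat)
  have "\<exists>w. prod_fact xs = p ^ (\<Sum>x\<leftarrow>xs. x div p) * prod_fact (map (\<lambda>x. x div p) xs) * w \<and>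
      [w = fact (p - 1) ^ (\<Sum>x\<leftarrow>xs. x div p) * prod_fact (map (\<lambda>x. x mod p) xs)] (mod p)"
  proof (induction xs)
    case (Cons x xs)
    then obtain w where w: "prod_fact xs = p ^ (\<Sum>x\<leftarrow>xs. x div p) * prod_fact (map (\<lambda>x. x div p) xs) * w"
      "[w = fact (p - 1) ^ (\<Sum>x\<leftarrow>xs. x div p) * prod_fact (map (\<lambda>x. x mod p) xs)] (mod p)"
      by blast
    obtain u where u: "fact x = p ^ (x div p) * fact (x div p) * u"
      "[u = fact (p - 1) ^ (x div p) * fact (x mod p)] (mod p)"
      using fact_div_mod[OF p0] .
    show ?case
      using cong_mult[OF u(2) w(2)]
      by (intro exI[of _ "u * w"]) (simp add: u(1) w(1) power_add ac_simps)
  qed auto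
  then obtain w where w: "prod_fact xs = p ^ (\<Sum>x\<leftarrow>xs. x div p) * prod_fact (map (\<lambda>x. x div p) xs) * w"
      "[w = fact (p - 1) ^ (\<Sum>x\<leftarrow>xs. x div p) * prod_fact (map (\<lambda>x. x mod p) xs)] (mod p)"
    by blast
  \<comment> \<open>Every factor here is the factorial of a number below \<open>p\<close>.\<close>
  have "\<not> p dvd fact (p - 1) ^ (\<Sum>x\<leftarrow>xs. x div p) * prod_fact (map (\<lambda>x. x mod p) xs)"
  proof -
    have "\<not> p dvd fact (p - 1)" using p p0 by (simp add: prime_dvd_fact_iff)
    then have "\<not> p dvd fact (p - 1) ^ k" for k using p prime_dvd_power_nat by blast
    then show ?thesis
      using p p0 by (simp add: prime_dvd_mult_iff prime_dvd_prod_fact_iff not_le)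
  qed
  then have "\<not> p dvd w"
    using cong_dvd_iff[OF w(2)] by simp
  with w that show thesis by blast
qed

text \<open>Legendre's formula, cut off at \<open>L\<close> because the later quotients are zero.
  Splitting off the multiples of \<open>p\<close> leaves the factorial of \<open>m div p\<close>, to
  which the induction on \<open>L\<close> applies.\<close>

lemma multiplicity_fact:
  fixes p :: nat
  assumes p: "prime p" and m: "m < p ^ L"
  shows "multiplicity p (fact m :: nat) = (\<Sum>l<L. m div p ^ Suc l)"
  using m
proof (induction L arbitrary: m)
  case (Suc L)
  obtain w where w: "prod_fact [m] = p ^ (\<Sum>x\<leftarrow>[m]. x div p) * prod_fact (map (\<lambda>x. x div p) [m]) * w"
    "\<not> p dvd w"
    using prod_fact_div_mod[OF p] by metis
  then have eq: "fact m = p ^ (m div p) * (fact (m div p) * w)"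
    by simp
  have w0: "w \<noteq> 0" using w(2) by (metis dvd_0_right)
  have "m div p < p ^ L"
    using Suc.prems p by (simp add: less_mult_imp_div_less mult.commute)
  then have IH: "multiplicity p (fact (m div p) :: nat) = (\<Sum>l<L. m div p div p ^ Suc l)"
    by (rule Suc.IH)
  have "multiplicity p (fact m :: nat) = m div p + multiplicity p (fact (m div p) :: nat)"
    using p w0 w(2) unfolding eq
    by (simp add: prime_elem_multiplicity_mult_distrib multiplicity_prime_power not_dvd_imp_multiplicity_0)
  also have "\<dots> = (\<Sum>l<Suc L. m div p ^ Suc l)"
    by (simp only: IH sum.lessThan_Suc_shift) (simp add: div_mult2_eq)
  finally show ?case .
qed auto

lemma multiplicity_prod_fact:
  fixes p :: nat
  assumes p: "prime p" and xs: "\<forall>x\<in>set xs. x < p ^ L"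
  shows "multiplicity p (prod_fact xs) = (\<Sum>l<L. \<Sum>x\<leftarrow>xs. x div p ^ Suc l)"
  using xs
proof (induction xs)
  case (Cons x xs)
  have "multiplicity p (prod_fact (x # xs)) = multiplicity p (fact x :: nat) + multiplicity p (prod_fact xs)"
    using p prod_fact_pos[of xs] by (simp add: prime_elem_multiplicity_mult_distrib)
  with Cons multiplicity_fact[OF p, of x L] show ?case by (simp add: sum.distrib)
qed auto

section \<open>Linear forms\<close>

lemma dot_add_nat: "dot a (v + p *s n) = dot a v + p * dot a n" for v n :: "nat ^ 'd"
  by (simp add: dot_def sum.distrib sum_distrib_left algebra_simps)

lemma dot_zero [simp]: "dot a 0 = 0" "dot 0 x = 0"
  by (simp_all add: dot_def)

lemma dot_axis: "dot a (axis i 1) = of_nat (a $ i)"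
  by (simp add: dot_def axis_def if_distrib cong: if_cong)

lemma dot_sum_list: "(\<Sum>a\<leftarrow>e. dot a n) = dot (sum_list e) n"
  by (induction e) (auto simp: dot_def sum.distrib algebra_simps)

lemma dot_mono: "(\<And>i. x $ i \<le> y $ i) \<Longrightarrow> dot a x \<le> dot a y"
  for x y :: "'a::linordered_semidom ^ 'd"
  by (auto simp: dot_def intro!: sum_mono mult_left_mono)

text \<open>Pairs are added one at a time. If \<open>w\<close> fails on the new pair, pass to
  \<open>axis i 1 + T *s w\<close>, with \<open>i\<close> a coordinate where that pair differs. For
  large \<open>T\<close> the old inequalities persist, since division by \<open>T\<close> recovers
  \<open>dot c w\<close>.\<close>

lemma separating_vector:
  assumes "finite P" "\<forall>(a, b)\<in>P. a \<noteq> b"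
  shows "\<exists>w. \<forall>(a, b)\<in>P. dot a w \<noteq> (dot b w :: nat)"
  using assms
proof (induction rule: finite_induct)
  case (insert q P)
  obtain a b where q: "q = (a, b)" by force
  from insert obtain w :: "nat ^ 'a" where w: "\<forall>(a, b)\<in>P. dot a w \<noteq> dot b w" by auto
  show ?case
  proof (cases "dot a w = dot b w")
    case True
    from insert.prems q have "a \<noteq> b" by auto
    then obtain i where i: "a $ i \<noteq> b $ i" by (auto simp: vec_eq_iff)
    have "finite ((\<lambda>(a, b). a $ i + b $ i) ` P)" using insert by simp
    then obtain T where T: "\<forall>(a, b)\<in>P. a $ i + b $ i < T"
      unfolding finite_nat_set_iff_bounded by fastforce
    have d: "dot c (axis i 1 + T *s w) = c $ i + T * dot c w" for c
      by (simp only: dot_add_nat dot_axis of_nat_id)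
    have "dot c (axis i 1 + T *s w) \<noteq> dot c' (axis i 1 + T *s w)" if "(c, c') \<in> P" for c c'
    proof
      assume "dot c (axis i 1 + T *s w) = dot c' (axis i 1 + T *s w)"
      moreover from T that have "c $ i < T" "c' $ i < T" by auto
      then have "(c $ i + T * dot c w) div T = dot c w" "(c' $ i + T * dot c' w) div T = dot c' w"
        by auto
      ultimately have "dot c w = dot c' w" by (simp only: d)
      with w that show False by auto
    qed
    moreover have "dot a (axis i 1 + T *s w) \<noteq> dot b (axis i 1 + T *s w)"
      unfolding d using i True by simp
    ultimately show ?thesis using q by auto
  next
    case False
    with w q show ?thesis by auto
  qed
qed auto

lemma ex_inj_on_dot:
  fixes A :: "(nat ^ 'd) set"
  assumes "finite A"
  obtains w :: "nat ^ 'd" where "inj_on (\<lambda>a. dot a w) A"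
proof -
  have "\<exists>w. \<forall>(a, b)\<in>{(a, b) \<in> A \<times> A. a \<noteq> b}. dot a w \<noteq> (dot b w :: nat)"
    by (rule separating_vector)
      (auto intro: finite_subset[OF _ finite_cartesian_product[OF assms assms]])
  then obtain w where w: "\<forall>(a, b)\<in>{(a, b) \<in> A \<times> A. a \<noteq> b}. dot a w \<noteq> (dot b w :: nat)" by blast
  have "inj_on (\<lambda>a. dot a w) A"
    using w by (auto simp: inj_on_def)
  then show thesis by (rule that)
qed

lemma eventually_infinite_witness:
  assumes "eventually P sequentially" and "infinite S"
  obtains p :: nat where "p \<in> S" "P p"
proof -
  obtain N where N: "\<And>n. n \<ge> N \<Longrightarrow> P n"
    using assms(1) by (auto simp: eventually_sequentially)
  obtain p where "p \<in> S" "p \<ge> N"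
    using assms(2) by (auto simp: infinite_nat_iff_unbounded_le)
  with N that show thesis by blast
qed

text \<open>
  Rounding \<open>p x\<close> up, rather than down, keeps every \<open>\<lfloor>dot a x\<rfloor>\<close> because the floor is continuous from the right.
\<close>

lemma eventually_digit_approx:
  fixes x :: "real ^ 'd"
  assumes x: "\<forall>i. 0 \<le> x $ i \<and> x $ i < 1" and A: "finite A"
  shows "eventually (\<lambda>p. \<exists>v\<in>digit_vectors p. \<forall>a\<in>A. int (dot a v div p) = \<lfloor>dot a x\<rfloor>) sequentially"
proof -
  have large: "eventually (\<lambda>p. c \<le> real p * d) sequentially" if "d > 0" for c d
  proof -
    have "eventually (\<lambda>p. c / d \<le> real p) sequentially"
      using filterlim_real_sequentially by (simp add: filterlim_at_top)
    then show ?thesis using that by (simp add: pos_divide_le_eq)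
  qed
  \<comment> \<open>The first bound keeps the rounded-up coordinates below \<open>p\<close>. In the
    second, \<open>dot a 1\<close> bounds the total rounding error, and the extra 1 makes the
    comparison strict.\<close>
  have "eventually (\<lambda>p. \<forall>i. 1 \<le> real p * (1 - x $ i)) sequentially"
    using x by (intro eventually_all_finite large) auto
  moreover have "eventually (\<lambda>p. \<forall>a\<in>A. real (dot a 1) + 1 \<le> real p * (\<lfloor>dot a x\<rfloor> + 1 - dot a x)) sequentially"
    using A by (intro eventually_ball_finite ballI large) linarith+
  ultimately show ?thesis
  proof eventually_elim
    case (elim p)
    define v :: "nat ^ 'd" where "v = (\<chi> i. nat \<lceil>p * x $ i\<rceil>)"
    have v: "p * x $ i \<le> v $ i" "v $ i < p * x $ i + 1" for i
    proof -
      have "0 \<le> p * x $ i" using x by simp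
      then have "real (v $ i) = of_int \<lceil>p * x $ i\<rceil>"
        by (simp add: v_def)
      then show "p * x $ i \<le> v $ i" "v $ i < p * x $ i + 1" by linarith+
    qed
    have "v \<in> digit_vectors p"
      unfolding digit_vectors_def
    proof (intro CollectI allI)
      fix i
      have "real (v $ i) < p" using v(2)[of i] elim(1)[rule_format, of i] by (simp add: algebra_simps)
      then show "v $ i < p" by simp
    qed
    moreover have "int (dot a v div p) = \<lfloor>dot a x\<rfloor>" if a: "a \<in> A" for a
    proof -
      have p: "p > 0" using elim(1) by (cases "p = 0") auto
      have r: "real (dot a v) = dot a (\<chi> i. real (v $ i))"
        by (simp add: dot_def)
      have "real p * dot a x = dot a (\<chi> i. p * x $ i)"
        by (simp add: dot_def sum_distrib_left ac_simps)
      also have "\<dots> \<le> real (dot a v)"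
        unfolding r using v(1) by (intro dot_mono) auto
      finally have lo: "dot a x \<le> real (dot a v) / p"
        using p by (simp add: field_simps)
      have "real (dot a v) \<le> dot a (\<chi> i. p * x $ i + 1)"
        unfolding r using v(2) by (intro dot_mono) (auto intro: less_imp_le)
      also have "\<dots> = real p * dot a x + real (dot a 1)"
        by (simp add: dot_def sum_distrib_left sum.distrib algebra_simps)
      also have "\<dots> < p * (\<lfloor>dot a x\<rfloor> + 1)"
        using elim(2) a by (auto simp: algebra_simps)
      finally have hi: "real (dot a v) / p < \<lfloor>dot a x\<rfloor> + 1"
        using p by (simp add: field_simps)
      have "\<lfloor>real (dot a v) / p\<rfloor> = \<lfloor>dot a x\<rfloor>"
        using lo hi by (intro floor_unique) linarith+
      then show ?thesis by (simp add: floor_divide_of_nat_eq)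
    qed
    ultimately show ?case by blast
  qed
qed

section \<open>Products of linear polynomials\<close>

text \<open>Both sides are polynomials in \<open>t\<close> agreeing at all naturals, so they have
  the same real roots \<open>- (j + 1) / c a\<close> with \<open>j < m a\<close>. Comparing the
  roots nearest 0 shows that the largest slope \<open>c a\<close> is zero.\<close>

lemma pochhammer_root_comparison:
  fixes m c :: "'a \<Rightarrow> nat" and C D :: nat
  assumes eq: "\<And>t. C * (\<Prod>a\<leftarrow>e. pochhammer (t * c a + 1) (m a)) = D * (\<Prod>a\<leftarrow>f. pochhammer (t * c a + 1) (m a))"
    and pos: "C > 0" "D > 0"
    and inj: "inj_on c (set e \<union> set f)" and disj: "set e \<inter> set f = {}"
    and a: "a \<in> set e \<union> set f" "m a > 0"
  shows "c a = 0"
proof -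
  define P :: "'a list \<Rightarrow> real poly" where
    "P e = (\<Prod>a\<leftarrow>e. \<Prod>j<m a. [:real j + 1, real (c a):])" for e
  have P: "poly (P e) (real t) = real (\<Prod>a\<leftarrow>e. pochhammer (t * c a + 1) (m a))" for e t
    by (induction e)
      (auto simp: P_def poly_prod pochhammer_prod lessThan_atLeast0 algebra_simps intro!: prod.cong)
  have "poly (smult (real C) (P e) - smult (real D) (P f)) (real t) = 0" for t
    using arg_cong[OF eq[of t], of real] by (simp add: P)
  then have "range real \<subseteq> {x. poly (smult (real C) (P e) - smult (real D) (P f)) x = 0}" by auto
  moreover have "infinite (range real)"
    by (simp add: finite_image_iff inj_on_def)
  ultimately have "smult (real C) (P e) - smult (real D) (P f) = 0"
    using poly_roots_finite finite_subset by blast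
  then have "real C * poly (P e) x = real D * poly (P f) x" for x
    by (metis eq_iff_diff_eq_0 poly_smult)
  then have "poly (P e) x = 0 \<longleftrightarrow> poly (P f) x = 0" for x
    using pos by (metis mult_eq_0_iff of_nat_eq_0_iff less_numeral_extra(3))
  moreover have "poly (P e) x = 0 \<longleftrightarrow> (\<exists>a\<in>set e. \<exists>j<m a. real j + 1 + x * real (c a) = 0)" for e x
    by (induction e) (auto simp: P_def poly_prod)
  ultimately have roots: "(\<exists>a\<in>set e. \<exists>j<m a. real j + 1 + x * real (c a) = 0) \<longleftrightarrow>
      (\<exists>a\<in>set f. \<exists>j<m a. real j + 1 + x * real (c a) = 0)" for x
    by simp
  \<comment> \<open>Forms with \<open>m a = 0\<close> contribute an empty product without roots, so
    the maximal slope is taken over the others.\<close>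
  define S where "S = {a \<in> set e \<union> set f. m a > 0}"
  have S: "finite S" "S \<noteq> {}" using a by (auto simp: S_def)
  obtain b where "b \<in> S" "c b = Max (c ` S)"
    using Max_in[of "c ` S"] S by fastforce
  then have b: "b \<in> S" "\<And>a. a \<in> S \<Longrightarrow> c a \<le> c b"
    using S by auto
  have "c b = 0"
  proof (rule ccontr)
    assume cb: "c b \<noteq> 0"
    have "real 0 + 1 + (- 1 / c b) * real (c b) = 0" "0 < m b" using cb b(1) by (auto simp: S_def)
    \<comment> \<open>The root \<open>- 1 / c b\<close> is the one closest to \<open>0\<close>, so on the other side it can only come from
      a form with the same slope.\<close>
    then obtain b' j where b': "b' \<in> S" "b' \<in> set e \<longleftrightarrow> b \<notin> set e" "j < m b'"
      "real j + 1 + (- 1 / c b) * real (c b') = 0"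
      using b(1) roots[of "- 1 / c b"] disj unfolding S_def by fastforce
    then have "(real j + 1) * c b = c b'" using cb by (simp add: field_simps)
    then have "(j + 1) * c b = c b'" by (metis of_nat_1 of_nat_add of_nat_eq_iff of_nat_mult)
    moreover have "c b' \<le> c b" using b(2) b'(1) .
    ultimately have "c b' = c b" using cb by (cases j) auto
    then have "b' = b" using inj b(1) b'(1) by (auto simp: S_def inj_on_def)
    with b' show False by auto
  qed
  moreover have "a \<in> S" using a by (simp add: S_def)
  ultimately show ?thesis using b(2) by fastforce
qed

section \<open>Integral factorial ratios\<close>

locale integral_factorial_ratio =
  fixes e f :: "(nat ^ 'd) list"
  assumes integral: "factorial_ratio e f n \<in> \<int>"
begin

text \<open>The ratio is a nonnegative integer, so neither the floor nor \<open>nat\<close> alters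
  it; congruences and multiplicities can be taken in the naturals.\<close>

definition Q :: "nat ^ 'd \<Rightarrow> nat" where
  "Q n = nat \<lfloor>factorial_ratio e f n\<rfloor>"

lemma factorial_ratio_eq:
  "factorial_ratio e f n =
    of_nat (prod_fact (map (\<lambda>a. dot a n) e)) / of_nat (prod_fact (map (\<lambda>a. dot a n) f))"
proof -
  have "(\<Prod>a\<leftarrow>e. fact (dot a n)) = (of_nat (prod_fact (map (\<lambda>a. dot a n) e)) :: rat)" for e
    by (induction e) auto
  then show ?thesis by (simp add: factorial_ratio_def)
qed

lemma of_nat_Q: "of_nat (Q n) = factorial_ratio e f n"
proof -
  have "factorial_ratio e f n \<ge> 0" by (simp add: factorial_ratio_eq)
  then have "of_nat (Q n) = (of_int \<lfloor>factorial_ratio e f n\<rfloor> :: rat)"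
    by (simp add: Q_def of_nat_nat)
  also have "\<dots> = factorial_ratio e f n"
    using integral[of n] by (auto elim!: Ints_cases)
  finally show ?thesis .
qed

lemma Q_mult: "Q n * prod_fact (map (\<lambda>a. dot a n) f) = prod_fact (map (\<lambda>a. dot a n) e)"
proof -
  have "of_nat (Q n * prod_fact (map (\<lambda>a. dot a n) f)) = (of_nat (prod_fact (map (\<lambda>a. dot a n) e)) :: rat)"
    using prod_fact_pos[of "map (\<lambda>a. dot a n) f"] by (simp add: of_nat_Q factorial_ratio_eq)
  then show ?thesis by (simp only: of_nat_eq_iff)
qed

lemma Q_pos: "Q n > 0"
  using Q_mult[of n] prod_fact_pos[of "map (\<lambda>a. dot a n) e"] by (cases "Q n") auto

lemma Q_0: "Q 0 = 1"
proof -
  have "prod_fact (map (\<lambda>a. dot a 0) xs) = 1" for xs :: "(nat ^ 'd) list"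
    by (induction xs) auto
  then show ?thesis using Q_mult[of 0] by simp
qed

lemma factorial_ratio_padic_Q: "factorial_ratio_padic p e f n = padic_of_int p (int (Q n))"
  unfolding factorial_ratio_padic_def of_nat_Q[symmetric] by simp

text \<open>The map from the integers is a ring homomorphism that pulls the maximal ideal back to
  the multiples of \<open>p\<close>.\<close>

lemma p_Lucas_iff:
  assumes p: "prime p"
  shows "p_Lucas p (factorial_ratio_padic p e f) \<longleftrightarrow>
    (\<forall>v\<in>digit_vectors p. \<forall>n. [Q (v + p *s n) = Q v * Q n] (mod p))"
proof -
  have p0: "p > 0" using p by (rule prime_gt_0_nat)
  interpret ring_hom_cring \<Z> "padic_ints p" "padic_of_int p"
    using padic_of_int_hom[OF p0] padic_ints_cring[OF p0] int_is_cring
    by (simp add: ring_hom_cring_def ring_hom_cring_axioms_def)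
  have "padic_of_int p a \<ominus>\<^bsub>padic_ints p\<^esub> padic_of_int p b \<otimes>\<^bsub>padic_ints p\<^esub> padic_of_int p c
      = padic_of_int p (a - b * c)" for a b c
  proof -
    have "padic_of_int p a = padic_of_int p (a - b * c) \<oplus>\<^bsub>padic_ints p\<^esub>
        padic_of_int p b \<otimes>\<^bsub>padic_ints p\<^esub> padic_of_int p c"
      using hom_add[of "a - b * c" "b * c"] hom_mult[of b c] by simp
    then show ?thesis
      using padic_of_int_closed[OF p0] by (simp add: S.minus_eq S.a_assoc S.r_neg)
  qed
  moreover have "int p dvd int a - int b * int c \<longleftrightarrow> [a = b * c] (mod p)" for a b c
    by (metis cong_iff_dvd_diff cong_int_iff of_nat_mult)
  ultimately show ?thesis
    by (simp add: p_Lucas_def factorial_ratio_padic_Q padic_of_int_mem_max_ideal_iff[OF p0])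
qed

lemma zero_digits_iff:
  assumes "prime p"
  shows "v \<in> zero_digits p (factorial_ratio_padic p e f) \<longleftrightarrow> v \<in> digit_vectors p \<and> p dvd Q v"
  using prime_gt_0_nat[OF assms]
  by (simp add: zero_digits_def factorial_ratio_padic_Q padic_of_int_mem_max_ideal_iff)

text \<open>Division of \<open>dot a (v + p *s n)\<close> by \<open>p\<close> has quotient
  \<open>quot a\<close> and the same remainder as \<open>dot a v\<close>. Modulo \<open>p\<close>,
  the units \<open>w\<close> and \<open>w'\<close> thus depend on \<open>n\<close> only through the
  exponent of \<open>fact (p - 1)\<close>.\<close>

lemma Q_split:
  fixes p :: nat and v n :: "nat ^ 'd"
  assumes p: "prime p"
  defines "quot \<equiv> \<lambda>a. dot a v div p + dot a n"
  obtains w w' where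
    "Q (v + p *s n) * (p ^ (\<Sum>a\<leftarrow>f. quot a) * prod_fact (map quot f) * w') =
      p ^ (\<Sum>a\<leftarrow>e. quot a) * prod_fact (map quot e) * w"
    and "[w = fact (p - 1) ^ (\<Sum>a\<leftarrow>e. quot a) * prod_fact (map (\<lambda>a. dot a v mod p) e)] (mod p)"
    and "[w' = fact (p - 1) ^ (\<Sum>a\<leftarrow>f. quot a) * prod_fact (map (\<lambda>a. dot a v mod p) f)] (mod p)"
    and "\<not> p dvd w" and "\<not> p dvd w'"
proof -
  have p0: "p > 0" using p by (rule prime_gt_0_nat)
  have q: "dot a (v + p *s n) div p = quot a" "dot a (v + p *s n) mod p = dot a v mod p" for a
    using p0 by (simp_all add: dot_add_nat quot_def)
  obtain w where "prod_fact (map (\<lambda>a. dot a (v + p *s n)) e) =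
      p ^ (\<Sum>a\<leftarrow>e. quot a) * prod_fact (map quot e) * w"
    "[w = fact (p - 1) ^ (\<Sum>a\<leftarrow>e. quot a) * prod_fact (map (\<lambda>a. dot a v mod p) e)] (mod p)" "\<not> p dvd w"
    using prod_fact_div_mod[OF p, of "map (\<lambda>a. dot a (v + p *s n)) e"] by (auto simp: o_def q)
  moreover obtain w' where "prod_fact (map (\<lambda>a. dot a (v + p *s n)) f) =
      p ^ (\<Sum>a\<leftarrow>f. quot a) * prod_fact (map quot f) * w'"
    "[w' = fact (p - 1) ^ (\<Sum>a\<leftarrow>f. quot a) * prod_fact (map (\<lambda>a. dot a v mod p) f)] (mod p)" "\<not> p dvd w'"
    using prod_fact_div_mod[OF p, of "map (\<lambda>a. dot a (v + p *s n)) f"] by (auto simp: o_def q)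
  ultimately show thesis
    using that[of w' w] Q_mult[of "v + p *s n"] by simp
qed

text \<open>Factorials of quotients below \<open>p\<close> are prime to \<open>p\<close>, so the
  multiplicity of \<open>p\<close> in \<open>Q (v + p *s n)\<close> is exactly the difference of the
  two sums.\<close>

lemma prime_dvd_Q_split:
  fixes p :: nat and v n :: "nat ^ 'd"
  assumes p: "prime p"
  defines "quot \<equiv> \<lambda>a. dot a v div p + dot a n"
  assumes large: "\<forall>a\<in>set e \<union> set f. quot a < p"
  shows "(\<Sum>a\<leftarrow>f. quot a) \<le> (\<Sum>a\<leftarrow>e. quot a)"
    and "p dvd Q (v + p *s n) \<longleftrightarrow> (\<Sum>a\<leftarrow>f. quot a) < (\<Sum>a\<leftarrow>e. quot a)"
proof -
  obtain w w' where w: "Q (v + p *s n) * (p ^ (\<Sum>a\<leftarrow>f. quot a) * prod_fact (map quot f) * w') =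
      p ^ (\<Sum>a\<leftarrow>e. quot a) * prod_fact (map quot e) * w"
    "[w = fact (p - 1) ^ (\<Sum>a\<leftarrow>e. quot a) * prod_fact (map (\<lambda>a. dot a v mod p) e)] (mod p)"
    "[w' = fact (p - 1) ^ (\<Sum>a\<leftarrow>f. quot a) * prod_fact (map (\<lambda>a. dot a v mod p) f)] (mod p)"
    "\<not> p dvd w" "\<not> p dvd w'"
    using Q_split[OF p, of v n, folded quot_def] .
  have "\<not> p dvd prod_fact (map quot e)" "\<not> p dvd prod_fact (map quot f)"
    using large p by (auto simp: prime_dvd_prod_fact_iff not_le)
  with w(4,5) have nd: "\<not> p dvd prod_fact (map quot e) * w" "\<not> p dvd prod_fact (map quot f) * w'"
    using p by (simp_all add: prime_dvd_mult_iff)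
  have mp: "multiplicity p (p ^ k * u) = k" if "\<not> p dvd u" for k u
  proof -
    have "u \<noteq> 0" using that by (metis dvd_0_right)
    then show ?thesis
      using p that prime_gt_0_nat[OF p]
      by (subst prime_elem_multiplicity_mult_distrib) (auto simp: not_dvd_imp_multiplicity_0)
  qed
  have mq: "multiplicity p (Q (v + p *s n) * u) = multiplicity p (Q (v + p *s n)) + multiplicity p u"
    if "u \<noteq> 0" for u
    using p that Q_pos[of "v + p *s n"] by (simp add: prime_elem_multiplicity_mult_distrib)
  have "p ^ (\<Sum>a\<leftarrow>f. quot a) * (prod_fact (map quot f) * w') \<noteq> 0"
    using nd(2) prime_gt_0_nat[OF p] by (metis dvd_0_right mult_eq_0_iff power_not_zero less_numeral_extra(3))
  moreover have "multiplicity p (Q (v + p *s n) * (p ^ (\<Sum>a\<leftarrow>f. quot a) * (prod_fact (map quot f) * w'))) =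
    multiplicity p (p ^ (\<Sum>a\<leftarrow>e. quot a) * (prod_fact (map quot e) * w))"
    using w(1) by (simp only: mult.assoc)
  ultimately have m: "multiplicity p (Q (v + p *s n)) + (\<Sum>a\<leftarrow>f. quot a) = (\<Sum>a\<leftarrow>e. quot a)"
    using mq by (simp only: mp nd not_False_eq_True)
  then show "(\<Sum>a\<leftarrow>f. quot a) \<le> (\<Sum>a\<leftarrow>e. quot a)" by simp
  have "p dvd Q (v + p *s n) \<longleftrightarrow> multiplicity p (Q (v + p *s n)) > 0"
    using p Q_pos[of "v + p *s n"] by (simp add: prime_multiplicity_gt_zero_iff)
  with m show "p dvd Q (v + p *s n) \<longleftrightarrow> (\<Sum>a\<leftarrow>f. quot a) < (\<Sum>a\<leftarrow>e. quot a)" by auto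
qed

text \<open>For \<open>q > 0\<close> this is the inequality defining the jump region, taken at
  \<open>v / q\<close>; the bounds on the coordinates come separately from
  \<open>digit_vectors q\<close>.\<close>

definition crosses :: "nat \<Rightarrow> nat ^ 'd \<Rightarrow> bool" where
  "crosses q v \<longleftrightarrow> (\<exists>a\<in>set e \<union> set f. q \<le> dot a v)"

lemma crosses_if_prime_dvd_Q:
  assumes "prime p" "p dvd Q v"
  shows "crosses p v"
proof -
  have "p dvd prod_fact (map (\<lambda>a. dot a v) e)"
    using assms(2) by (metis Q_mult dvd_mult2)
  with assms(1) show ?thesis by (auto simp: prime_dvd_prod_fact_iff crosses_def)
qed

section \<open>Valuations of \<open>Q\<close> and values of \<open>Delta\<close> at
  \<open>v / q\<close>\<close>

lemma floor_dot_scaled: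
  "\<lfloor>dot a (\<chi> i. real (v $ i) / real q)\<rfloor> = int (dot a v div q)"
proof -
  have "dot a (\<chi> i. real (v $ i) / real q) = real (dot a v) / real q"
    by (simp add: dot_def sum_divide_distrib)
  then show ?thesis by (simp add: floor_divide_of_nat_eq)
qed

lemma Delta_scaled:
  "Delta e f (\<chi> i. real (v $ i) / real q) = int (\<Sum>a\<leftarrow>e. dot a v div q) - int (\<Sum>a\<leftarrow>f. dot a v div q)"
proof -
  have "(\<Sum>a\<leftarrow>e. \<lfloor>dot a (\<chi> i. real (v $ i) / real q)\<rfloor>) = int (\<Sum>a\<leftarrow>e. dot a v div q)" for e
    by (induction e) (auto simp: floor_dot_scaled)
  then show ?thesis by (simp add: Delta_def)
qed

lemma scaled_mem_jump_region:
  assumes "v \<in> digit_vectors q" "crosses q v"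
  shows "(\<chi> i. real (v $ i) / real q) \<in> jump_region e f"
proof -
  have "q > 0" using assms(1) by (auto simp: digit_vectors_def intro: Nat.gr0I)
  moreover have "dot a (\<chi> i. real (v $ i) / real q) = real (dot a v) / real q" for a
    by (simp add: dot_def sum_divide_distrib)
  ultimately show ?thesis
    using assms by (auto simp: jump_region_def digit_vectors_def crosses_def)
qed

lemma sum_list_dot_div:
  fixes v n :: "nat ^ 'd"
  shows "q > 0 \<Longrightarrow> (\<Sum>a\<leftarrow>xs. dot a (v + q *s n) div q) = (\<Sum>a\<leftarrow>xs. dot a v div q) + dot (sum_list xs) n"
  by (simp add: dot_add_nat sum_list_addf dot_sum_list)

text \<open>By \<open>bal\<close>, reducing \<open>n\<close> modulo \<open>q\<close> lowers both
  sums equally. At the residue, a crossing yields a gap of 1 through \<open>ge1\<close>; without a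
  crossing the left side is zero.\<close>

lemma sum_div_gap:
  assumes bal: "sum_list e = sum_list f" and ge1: "\<forall>x\<in>jump_region e f. Delta e f x \<ge> 1" and q: "q > 0"
  shows "(\<Sum>a\<leftarrow>f. dot a n div q) + (if crosses q (\<chi> i. n $ i mod q) then 1 else 0) \<le> (\<Sum>a\<leftarrow>e. dot a n div q)"
proof -
  define r s where "r = (\<chi> i. n $ i mod q)" and "s = (\<chi> i. n $ i div q)"
  have n: "n = r + q *s s" by (simp add: r_def s_def vec_eq_iff)
  have r: "r \<in> digit_vectors q" using q by (simp add: r_def digit_vectors_def)
  have "(\<Sum>a\<leftarrow>f. dot a r div q) + (if crosses q r then 1 else 0) \<le> (\<Sum>a\<leftarrow>e. dot a r div q)"
  proof (cases "crosses q r")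
    case True
    then show ?thesis
      using ge1 scaled_mem_jump_region[OF r True] Delta_scaled[of r q] by force
  next
    case False
    then have "dot a r div q = 0" if "a \<in> set f" for a using that by (auto simp: crosses_def not_le)
    with False have "(\<Sum>a\<leftarrow>f. dot a r div q) + (if crosses q r then 1 else 0) = 0"
      by (simp add: sum_list_eq_0_iff)
    then show ?thesis by linarith
  qed
  then show ?thesis
    unfolding r_def[symmetric] using q by (subst (1 2) n) (simp add: sum_list_dot_div bal)
qed

text \<open>By Legendre's formula the multiplicity is the sum over \<open>l\<close> of the gaps for
  the divisors \<open>p ^ Suc l\<close>, and each crossing contributes at least 1.\<close>

lemma card_crosses_le_multiplicity:
  assumes bal: "sum_list e = sum_list f" and ge1: "\<forall>x\<in>jump_region e f. Delta e f x \<ge> 1" and p: "prime p"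
  shows "card {l \<in> {..<L}. crosses (p ^ Suc l) (\<chi> i. n $ i mod p ^ Suc l)} \<le> multiplicity p (Q n)"
proof -
  \<comment> \<open>Large enough for Legendre's formula to apply to all factorials in
    \<open>Q n\<close>, and at least \<open>L\<close>, so that every level below \<open>L\<close> is
    summed.\<close>
  define N where "N = L + (\<Sum>a\<leftarrow>e. dot a n) + (\<Sum>a\<leftarrow>f. dot a n)"
  have p2: "p \<ge> 2" using p by (rule prime_ge_2_nat)
  have "dot a n < p ^ N" if "a \<in> set e \<union> set f" for a
  proof -
    have "dot a n \<le> N"
      using that member_le_sum_list[of "dot a n" "map (\<lambda>a. dot a n) e"]
        member_le_sum_list[of "dot a n" "map (\<lambda>a. dot a n) f"] by (auto simp: N_def)
    also have "N < 2 ^ N" by (rule less_exp)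
    also have "2 ^ N \<le> p ^ N" using p2 by (rule power_mono) simp
    finally show ?thesis .
  qed
  then have mult: "multiplicity p (prod_fact (map (\<lambda>a. dot a n) e)) = (\<Sum>l<N. \<Sum>a\<leftarrow>e. dot a n div p ^ Suc l)"
    "multiplicity p (prod_fact (map (\<lambda>a. dot a n) f)) = (\<Sum>l<N. \<Sum>a\<leftarrow>f. dot a n div p ^ Suc l)"
    by (subst multiplicity_prod_fact[OF p]; auto simp: o_def)+
  have "multiplicity p (Q n) + (\<Sum>l<N. \<Sum>a\<leftarrow>f. dot a n div p ^ Suc l) = (\<Sum>l<N. \<Sum>a\<leftarrow>e. dot a n div p ^ Suc l)"
    unfolding mult[symmetric] Q_mult[of n, symmetric]
    using p Q_pos[of n] prod_fact_pos[of "map (\<lambda>a. dot a n) f"]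
    by (simp add: prime_elem_multiplicity_mult_distrib)
  moreover have "(\<Sum>l<N. (\<Sum>a\<leftarrow>f. dot a n div p ^ Suc l) +
        (if crosses (p ^ Suc l) (\<chi> i. n $ i mod p ^ Suc l) then 1 else 0)) \<le>
      (\<Sum>l<N. \<Sum>a\<leftarrow>e. dot a n div p ^ Suc l)"
    using p2 by (intro sum_mono sum_div_gap[OF bal ge1]) simp
  moreover have "(\<Sum>l<N. if crosses (p ^ Suc l) (\<chi> i. n $ i mod p ^ Suc l) then 1 else 0) =
      card {l \<in> {..<N}. crosses (p ^ Suc l) (\<chi> i. n $ i mod p ^ Suc l)}"
    by (simp add: sum.If_cases Int_def)
  ultimately have "card {l \<in> {..<N}. crosses (p ^ Suc l) (\<chi> i. n $ i mod p ^ Suc l)} \<le> multiplicity p (Q n)"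
    by (simp only: sum.distrib)
  moreover have "card {l \<in> {..<L}. crosses (p ^ Suc l) (\<chi> i. n $ i mod p ^ Suc l)} \<le>
      card {l \<in> {..<N}. crosses (p ^ Suc l) (\<chi> i. n $ i mod p ^ Suc l)}"
    by (rule card_mono) (auto simp: N_def)
  ultimately show ?thesis by linarith
qed

lemma prime_dvd_Q_if_crosses:
  assumes bal: "sum_list e = sum_list f" and ge1: "\<forall>x\<in>jump_region e f. Delta e f x \<ge> 1" and p: "prime p"
    and v: "v \<in> digit_vectors p" and c: "crosses p v"
  shows "p dvd Q (v + p *s n)"
proof -
  \<comment> \<open>Level \<open>l = 0\<close> alone forces a factor \<open>p\<close>: the residue
    of \<open>v + p *s n\<close> there is \<open>v\<close>, which crosses.\<close>
  have "(\<chi> i. (v + p *s n) $ i mod p) = v"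
    using v by (simp add: digit_vectors_def vec_eq_iff)
  with c have "{l \<in> {..<1}. crosses (p ^ Suc l) (\<chi> i. (v + p *s n) $ i mod p ^ Suc l)} = {0}"
    by auto
  with card_crosses_le_multiplicity[OF bal ge1 p, where L = 1 and n = "v + p *s n"]
  have "1 \<le> multiplicity p (Q (v + p *s n))" by simp
  then show ?thesis using p Q_pos[of "v + p *s n"] multiplicity_dvd'[of 1 p "Q (v + p *s n)"] by simp
qed

section \<open>Sufficiency: Lucas congruences and divisibility by \<open>p ^ alpha\<close>\<close>

theorem Lucas_congruence:
  assumes bal: "sum_list e = sum_list f" and ge1: "\<forall>x\<in>jump_region e f. Delta e f x \<ge> 1" and p: "prime p"
    and v: "v \<in> digit_vectors p"
  shows "[Q (v + p *s n) = Q v * Q n] (mod p)"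
proof (cases "crosses p v")
  case True
  \<comment> \<open>The instance at 0 says \<open>p dvd Q v\<close>, so both sides of the congruence
    vanish.\<close>
  have "p dvd Q (v + p *s n)" "p dvd Q (v + p *s 0)"
    by (rule prime_dvd_Q_if_crosses[OF bal ge1 p v True])+
  then show ?thesis by (simp add: cong_def mod_eq_0_iff_dvd)
next
  case False
  then have small: "dot a v < p" if "a \<in> set e \<union> set f" for a using that by (auto simp: crosses_def not_le)
  then have q: "map (\<lambda>a. dot a v div p + dot a n) e = map (\<lambda>a. dot a n) e"
      "map (\<lambda>a. dot a v div p + dot a n) f = map (\<lambda>a. dot a n) f"
    and r: "map (\<lambda>a. dot a v mod p) e = map (\<lambda>a. dot a v) e"
      "map (\<lambda>a. dot a v mod p) f = map (\<lambda>a. dot a v) f"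
    by auto
  \<comment> \<open>As \<open>dot a v div p = 0\<close>, this is by \<open>bal\<close> the quotient
    sum for both tuples, so the powers of \<open>p\<close> and of \<open>fact (p - 1)\<close>
    match.\<close>
  define s where "s = dot (sum_list f) n"
  obtain w w' where w: "Q (v + p *s n) * (p ^ s * prod_fact (map (\<lambda>a. dot a n) f) * w') =
      p ^ s * prod_fact (map (\<lambda>a. dot a n) e) * w"
    "[w = fact (p - 1) ^ s * prod_fact (map (\<lambda>a. dot a v) e)] (mod p)"
    "[w' = fact (p - 1) ^ s * prod_fact (map (\<lambda>a. dot a v) f)] (mod p)"
    "\<not> p dvd w" "\<not> p dvd w'"
    using Q_split[OF p, of v n, unfolded q r dot_sum_list bal, folded s_def] .
  have "p ^ s * prod_fact (map (\<lambda>a. dot a n) f) * (Q (v + p *s n) * w') =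
      p ^ s * prod_fact (map (\<lambda>a. dot a n) f) * (Q n * w)"
    using w(1) unfolding Q_mult[of n, symmetric] by (simp only: ac_simps)
  then have "Q (v + p *s n) * w' = Q n * w"
    using p prod_fact_pos[of "map (\<lambda>a. dot a n) f"] by (simp add: prime_gt_0_nat)
  also have "[Q n * w = Q n * (fact (p - 1) ^ s * prod_fact (map (\<lambda>a. dot a v) e))] (mod p)"
    by (intro cong_mult w(2) cong_refl)
  also have "Q n * (fact (p - 1) ^ s * prod_fact (map (\<lambda>a. dot a v) e)) =
      Q v * Q n * (fact (p - 1) ^ s * prod_fact (map (\<lambda>a. dot a v) f))"
    unfolding Q_mult[of v, symmetric] by (simp only: ac_simps)
  also have "[\<dots> = Q v * Q n * w'] (mod p)"
    by (intro cong_mult cong_sym[OF w(3)] cong_refl)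
  finally show ?thesis
    using p w(5) by (subst (asm) cong_mult_rcancel_nat) (auto simp: coprime_commute prime_imp_coprime_nat)
qed

theorem power_alpha_dvd_Q:
  assumes bal: "sum_list e = sum_list f" and ge1: "\<forall>x\<in>jump_region e f. Delta e f x \<ge> 1" and p: "prime p"
  shows "p ^ alpha p (factorial_ratio_padic p e f) n dvd Q n"
proof -
  have p0: "p > 0" using p by (rule prime_gt_0_nat)
  have "crosses (p ^ Suc k) (\<chi> i. n $ i mod p ^ Suc k)"
    if "digit p n k \<in> zero_digits p (factorial_ratio_padic p e f)" for k
  proof -
    from that have "crosses p (digit p n k)"
      using p crosses_if_prime_dvd_Q by (simp add: zero_digits_iff)
    then obtain a where a: "a \<in> set e \<union> set f" "p \<le> dot a (digit p n k)" by (auto simp: crosses_def)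
    \<comment> \<open>The digit at \<open>k\<close> is the leading digit of the residue of
      \<open>n\<close> modulo \<open>p ^ Suc k\<close>, so a crossing of \<open>p\<close> by the
      digit becomes a crossing of \<open>p ^ Suc k\<close> by the residue.\<close>
    have "p ^ Suc k \<le> p ^ k * dot a (digit p n k)" using a(2) by simp
    also have "\<dots> = dot a (p ^ k *s digit p n k)"
      using dot_add_nat[of a 0 "p ^ k" "digit p n k"] by simp
    also have "\<dots> \<le> dot a (\<chi> i. n $ i mod p ^ Suc k)"
      by (rule dot_mono) (simp add: digit_def mod_mult2_eq mult.commute[of p])
    finally show ?thesis using a(1) by (auto simp: crosses_def)
  qed
  then have "alpha p (factorial_ratio_padic p e f) n \<le>
      card {l \<in> {..<Suc (top_index p n)}. crosses (p ^ Suc l) (\<chi> i. n $ i mod p ^ Suc l)}"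
    unfolding alpha_def by (intro card_mono) auto
  also have "\<dots> \<le> multiplicity p (Q n)"
    by (rule card_crosses_le_multiplicity[OF bal ge1 p])
  finally show ?thesis by (rule multiplicity_dvd')
qed

section \<open>Necessity: finiteness of the set of Lucas primes\<close>

definition Lucas_primes :: "nat set" where
  "Lucas_primes = {p. prime p \<and> (\<forall>v\<in>digit_vectors p. \<forall>n. [Q (v + p *s n) = Q v * Q n] (mod p))}"

lemma Lucas_primes_eq: "Lucas_primes = {p. prime p \<and> p_Lucas p (factorial_ratio_padic p e f)}"
  using p_Lucas_iff by (auto simp: Lucas_primes_def)

theorem finite_Lucas_primes_if_unbalanced:
  assumes "sum_list e \<noteq> sum_list f"
  shows "finite Lucas_primes"
proof -
  obtain i where i: "sum_list e $ i \<noteq> sum_list f $ i"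
    using assms by (auto simp: vec_eq_iff)
  \<comment> \<open>This unit vector makes the two sums of \<open>dot a n\<close> differ, while a
    prime above \<open>B\<close> divides none of the factorials in \<open>Q n\<close>.\<close>
  define n :: "nat ^ 'd" where "n = axis i 1"
  define B where "B = (\<Sum>a\<leftarrow>e. dot a n) + (\<Sum>a\<leftarrow>f. dot a n)"
  have B: "dot a n \<le> B" if "a \<in> set e \<union> set f" for a
    using that member_le_sum_list[of "dot a n" "map (\<lambda>a. dot a n) e"]
      member_le_sum_list[of "dot a n" "map (\<lambda>a. dot a n) f"] by (auto simp: B_def)
  have "p \<le> B" if p: "p \<in> Lucas_primes" for p
  proof (rule ccontr)
    assume "\<not> p \<le> B"
    with B have lt: "dot a n < p" if "a \<in> set e \<union> set f" for a using that by fastforce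
    have pr: "prime p" using p by (simp add: Lucas_primes_def)
    have quot: "dot a 0 div p + dot a n = dot a n" for a by simp
    have large: "\<forall>a\<in>set e \<union> set f. dot a 0 div p + dot a n < p" using lt by simp
    have ne: "(\<Sum>a\<leftarrow>f. dot a n) \<noteq> (\<Sum>a\<leftarrow>e. dot a n)"
      using i unfolding dot_sum_list unfolding n_def dot_axis by simp
    \<comment> \<open>Integrality already orders the two sums, so being different they are strictly
      ordered.\<close>
    then have "p dvd Q (0 + p *s n)"
      using prime_dvd_Q_split[OF pr large] unfolding quot by simp
    moreover have "[Q (0 + p *s n) = Q 0 * Q n] (mod p)"
    proof -
      have "0 \<in> digit_vectors p" using prime_gt_0_nat[OF pr] by (simp add: digit_vectors_def)
      then show ?thesis using p unfolding Lucas_primes_def by blast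
    qed
    ultimately have "p dvd Q n" by (simp add: cong_dvd_iff Q_0)
    then have "crosses p n" by (rule crosses_if_prime_dvd_Q[OF pr])
    with lt show False by (auto simp: crosses_def not_le[symmetric])
  qed
  then show ?thesis by (meson finite_nat_set_iff_bounded_le)
qed

text \<open>One half of Landau's criterion. Approximate \<open>x\<close> by \<open>v / p\<close>
  with \<open>p\<close> a prime above all the floors; then \<open>Delta e f x\<close> is the
  multiplicity of \<open>p\<close> in \<open>Q v\<close>.\<close>

lemma Delta_nonneg:
  assumes x: "\<forall>i. 0 \<le> x $ i \<and> x $ i < 1"
  shows "Delta e f x \<ge> 0"
proof -
  have "eventually (\<lambda>p. \<forall>a\<in>set e \<union> set f. nat \<lfloor>dot a x\<rfloor> < p) sequentially"
    by (intro eventually_ball_finite ballI eventually_gt_at_top) auto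
  moreover have "finite (set e \<union> set f)" by simp
  ultimately obtain p where "p \<in> {p. prime p}" and p': "(\<forall>a\<in>set e \<union> set f. nat \<lfloor>dot a x\<rfloor> < p) \<and>
      (\<exists>v\<in>digit_vectors p. \<forall>a\<in>set e \<union> set f. int (dot a v div p) = \<lfloor>dot a x\<rfloor>)"
    by (rule eventually_infinite_witness[OF eventually_conj[OF _ eventually_digit_approx[OF x]] primes_infinite])
  then have p: "prime p" "\<forall>a\<in>set e \<union> set f. nat \<lfloor>dot a x\<rfloor> < p" by auto
  obtain v where v: "\<forall>a\<in>set e \<union> set f. int (dot a v div p) = \<lfloor>dot a x\<rfloor>"
    using p' by blast
  have large: "\<forall>a\<in>set e \<union> set f. dot a v div p + dot a 0 < p"
    using p(2) v by (metis add.right_neutral dot_zero(1) nat_int)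
  have "(\<Sum>a\<leftarrow>f. dot a v div p) \<le> (\<Sum>a\<leftarrow>e. dot a v div p)"
    using prime_dvd_Q_split(1)[OF p(1) large] by simp
  moreover have "(\<Sum>a\<leftarrow>xs. \<lfloor>dot a x\<rfloor>) = int (\<Sum>a\<leftarrow>xs. dot a v div p)" if "set xs \<subseteq> set e \<union> set f" for xs
    using that v by (induction xs) auto
  ultimately show ?thesis by (simp add: Delta_def)
qed

text \<open>The splittings of \<open>Q\<close> at \<open>v + p *s n\<close> and at \<open>v\<close>
  share the remainder products \<open>R\<close> and \<open>R'\<close>, and equal sums cancel the
  powers of \<open>p\<close> and \<open>c\<close>. The Lucas congruence links the two and eliminates
  \<open>R\<close>, \<open>R'\<close> and \<open>Q v\<close>.\<close>

lemma Lucas_cross_congruence: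
  fixes m :: "nat ^ 'd \<Rightarrow> nat"
  assumes p: "p \<in> Lucas_primes" and v: "v \<in> digit_vectors p"
    and m: "\<forall>a\<in>set e \<union> set f. dot a v div p = m a"
    and bal: "sum_list e = sum_list f" and eq: "(\<Sum>a\<leftarrow>e. m a) = (\<Sum>a\<leftarrow>f. m a)"
  shows "[prod_fact (map (\<lambda>a. m a + dot a n) e) * prod_fact (map m f) =
    Q n * prod_fact (map (\<lambda>a. m a + dot a n) f) * prod_fact (map m e)] (mod p)"
proof -
  have pr: "prime p" using p by (simp add: Lucas_primes_def)
  define E F where "E n = prod_fact (map (\<lambda>a. m a + dot a n) e)"
    and "F n = prod_fact (map (\<lambda>a. m a + dot a n) f)" for n
  define R R' where "R = prod_fact (map (\<lambda>a. dot a v mod p) e)"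
    and "R' = prod_fact (map (\<lambda>a. dot a v mod p) f)"
  define c :: nat where "c = fact (p - 1)"
  have "\<not> p dvd c" using pr prime_gt_0_nat[OF pr] by (simp add: c_def prime_dvd_fact_iff)
  then have "coprime c p" using prime_imp_coprime_nat[OF pr] coprime_commute by blast
  then have c: "coprime (c ^ k) p" for k by simp
  have "\<not> p dvd R" using pr prime_gt_0_nat[OF pr] by (auto simp: R_def prime_dvd_prod_fact_iff not_le)
  then have R: "coprime R p" using prime_imp_coprime_nat[OF pr] coprime_commute by blast
  have split: "[Q (v + p *s n) * F n * R' = E n * R] (mod p)" for n
  proof -
    have q: "map (\<lambda>a. dot a v div p + dot a n) e = map (\<lambda>a. m a + dot a n) e"
      "map (\<lambda>a. dot a v div p + dot a n) f = map (\<lambda>a. m a + dot a n) f"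
      using m by auto
    define s where "s = (\<Sum>a\<leftarrow>f. m a + dot a n)"
    have s: "(\<Sum>a\<leftarrow>e. m a + dot a n) = s"
      unfolding s_def sum_list_addf dot_sum_list by (simp add: bal eq)
    obtain w w' where w: "Q (v + p *s n) * (p ^ s * F n * w') = p ^ s * E n * w"
      "[w = c ^ s * R] (mod p)" "[w' = c ^ s * R'] (mod p)" "\<not> p dvd w" "\<not> p dvd w'"
      using Q_split[OF pr, of v n, unfolded q s, folded s_def E_def F_def R_def R'_def c_def] .
    have "p ^ s * (Q (v + p *s n) * F n * w') = p ^ s * (E n * w)"
      using w(1) by (simp only: ac_simps)
    then have eq: "Q (v + p *s n) * F n * w' = E n * w"
      using prime_gt_0_nat[OF pr] by simp
    have "[Q (v + p *s n) * F n * (c ^ s * R') = Q (v + p *s n) * F n * w'] (mod p)"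
      by (intro cong_mult cong_refl cong_sym[OF w(3)])
    also note eq
    also have "[E n * w = E n * (c ^ s * R)] (mod p)"
      by (intro cong_mult cong_refl w(2))
    finally have "[Q (v + p *s n) * F n * R' * c ^ s = E n * R * c ^ s] (mod p)"
      by (simp only: ac_simps)
    then show ?thesis using cong_mult_rcancel_nat[OF c] by blast
  qed
  have Lucas: "[Q (v + p *s n) = Q v * Q n] (mod p)"
    using p v by (simp add: Lucas_primes_def)
  have "[E n * F 0 * R = Q (v + p *s n) * F n * R' * F 0] (mod p)"
    using cong_mult[OF cong_sym[OF split[of n]] cong_refl[of "F 0"]] by (simp only: ac_simps)
  also have "[Q (v + p *s n) * F n * R' * F 0 = Q v * Q n * F n * R' * F 0] (mod p)"
    by (intro cong_mult cong_refl Lucas)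
  \<comment> \<open>As \<open>v + p *s 0 = v\<close>, \<open>split\<close> at 0 trades
    \<open>Q v * F 0 * R'\<close> for \<open>E 0 * R\<close>, after which the unit \<open>R\<close>
    cancels.\<close>
  also have "Q v * Q n * F n * R' * F 0 = Q n * F n * (Q (v + p *s 0) * F 0 * R')"
    by simp
  also have "[\<dots> = Q n * F n * (E 0 * R)] (mod p)"
    by (intro cong_mult cong_refl split)
  also have "Q n * F n * (E 0 * R) = Q n * F n * E 0 * R"
    by (simp only: ac_simps)
  finally have "[E n * F 0 = Q n * F n * E 0] (mod p)"
    using cong_mult_rcancel_nat[OF R] by blast
  then show ?thesis by (simp add: E_def F_def)
qed

theorem finite_Lucas_primes_if_Delta_eq_0:
  assumes bal: "sum_list e = sum_list f" and disj: "set e \<inter> set f = {}"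
    and x: "x \<in> jump_region e f" "Delta e f x = 0"
  shows "finite Lucas_primes"
proof (rule ccontr)
  assume inf: "infinite Lucas_primes"
  define m where "m a = nat \<lfloor>dot a x\<rfloor>" for a :: "nat ^ 'd"
  have x01: "\<forall>i. 0 \<le> x $ i \<and> x $ i < 1" using x(1) by (simp add: jump_region_def)
  then have "dot a x \<ge> 0" for a
    by (auto simp: dot_def intro!: sum_nonneg)
  then have m: "int (m a) = \<lfloor>dot a x\<rfloor>" for a by (simp add: m_def)
  have "(\<Sum>a\<leftarrow>xs. \<lfloor>dot a x\<rfloor>) = int (\<Sum>a\<leftarrow>xs. m a)" for xs
    by (induction xs) (auto simp: m)
  then have sums: "(\<Sum>a\<leftarrow>e. m a) = (\<Sum>a\<leftarrow>f. m a)" using x(2) by (simp add: Delta_def)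
  have eq: "prod_fact (map (\<lambda>a. m a + dot a n) e) * prod_fact (map m f) =
    Q n * prod_fact (map (\<lambda>a. m a + dot a n) f) * prod_fact (map m e)" (is "?l = ?r") for n
  proof -
    \<comment> \<open>A congruence modulo a prime exceeding both sides is an equality.\<close>
    have "eventually (\<lambda>p. ?l < p \<and> ?r < p) sequentially"
      by (intro eventually_conj eventually_gt_at_top)
    moreover have "finite (set e \<union> set f)" by simp
    ultimately obtain p where p': "p \<in> Lucas_primes" "(?l < p \<and> ?r < p) \<and>
        (\<exists>v\<in>digit_vectors p. \<forall>a\<in>set e \<union> set f. int (dot a v div p) = \<lfloor>dot a x\<rfloor>)"
      by (rule eventually_infinite_witness[OF eventually_conj[OF _ eventually_digit_approx[OF x01]] inf])
    then have p: "p \<in> Lucas_primes" "?l < p" "?r < p" by blast+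
    from p'(2) obtain v where v: "v \<in> digit_vectors p" "\<forall>a\<in>set e \<union> set f. dot a v div p = m a"
      unfolding m[symmetric] of_nat_eq_iff by blast
    show ?thesis
      using Lucas_cross_congruence[OF p(1) v bal sums, of n] p(2,3)
      by (simp only: cong_def mod_less)
  qed
  have poch: "prod_fact (map m f) * (\<Prod>a\<leftarrow>e. pochhammer (dot a n + 1) (m a)) =
      prod_fact (map m e) * (\<Prod>a\<leftarrow>f. pochhammer (dot a n + 1) (m a))" (is "?l = ?r") for n
  proof -
    \<comment> \<open>Multiplying \<open>Q n\<close> by its denominator restores the numerator, a
      positive factor common to both sides.\<close>
    have "prod_fact (map (\<lambda>a. dot a n) e) * ?l = prod_fact (map (\<lambda>a. dot a n) e) * ?r"
      using eq[of n] unfolding prod_fact_add Q_mult[of n, symmetric] by (simp only: ac_simps)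
    then show ?thesis using prod_fact_pos[of "map (\<lambda>a. dot a n) e"] by simp
  qed
  \<comment> \<open>Including 0 ensures that \<open>dot a w = 0\<close> forces
    \<open>a = 0\<close>.\<close>
  obtain w :: "nat ^ 'd" where w: "inj_on (\<lambda>a. dot a w) (insert 0 (set e \<union> set f))"
    using ex_inj_on_dot[of "insert 0 (set e \<union> set f)"] by blast
  have dot_w: "t * dot a w = dot a (t *s w)" for a t
    using dot_add_nat[of a 0 t w] by simp
  \<comment> \<open>Here \<open>m a \<ge> 1\<close>, so the root comparison gives slope 0 and hence
    \<open>a = 0\<close>, against \<open>dot a x \<ge> 1\<close>.\<close>
  obtain a where a: "a \<in> set e \<union> set f" "dot a x \<ge> 1"
    using x(1) by (auto simp: jump_region_def)
  have "dot a w = 0"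
  proof (rule pochhammer_root_comparison[where c = "\<lambda>a. dot a w" and m = m])
    show "prod_fact (map m f) * (\<Prod>a\<leftarrow>e. pochhammer (t * dot a w + 1) (m a)) =
      prod_fact (map m e) * (\<Prod>a\<leftarrow>f. pochhammer (t * dot a w + 1) (m a))" for t
      unfolding dot_w by (rule poch)
    show "inj_on (\<lambda>a. dot a w) (set e \<union> set f)" using w by (rule inj_on_subset) auto
    show "m a > 0" using a(2) by (simp add: m_def)
  qed (use disj a in auto)
  then have "a = 0" using inj_onD[OF w, of a 0] a(1) by simp
  with a(2) show False by simp
qed

end

theorem theorem3:
  fixes e f :: "(nat ^ 'd) list"
  assumes disjoint: "set e \<inter> set f = {}"
    and integral: "\<forall>n. factorial_ratio e f n \<in> \<int>"
  shows
    "(sum_list e = sum_list f \<and> (\<forall>x\<in>jump_region e f. Delta e f x \<ge> 1)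
        \<longrightarrow> (\<forall>p. prime p \<longrightarrow> p_Lucas p (factorial_ratio_padic p e f))) \<and>
     (sum_list e \<noteq> sum_list f \<or> (\<exists>x\<in>jump_region e f. Delta e f x = 0)
        \<longrightarrow> finite {p. prime p \<and> p_Lucas p (factorial_ratio_padic p e f)}) \<and>
     ((\<forall>p. prime p \<longrightarrow> p_Lucas p (factorial_ratio_padic p e f))
        \<longrightarrow> (\<forall>p n. prime p \<longrightarrow>
              (\<exists>z::int. factorial_ratio e f n = of_nat p ^ alpha p (factorial_ratio_padic p e f) n * of_int z)))"
proof -
  interpret integral_factorial_ratio e f
    by unfold_locales (use integral in blast)
  have finite: "finite Lucas_primes"
    if "sum_list e \<noteq> sum_list f \<or> (\<exists>x\<in>jump_region e f. Delta e f x = 0)"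
    using that finite_Lucas_primes_if_unbalanced finite_Lucas_primes_if_Delta_eq_0[OF _ disjoint] by blast
  have "\<exists>z::int. factorial_ratio e f n = of_nat p ^ alpha p (factorial_ratio_padic p e f) n * of_int z"
    if all: "\<forall>p. prime p \<longrightarrow> p_Lucas p (factorial_ratio_padic p e f)" and p: "prime p" for p n
  proof -
    \<comment> \<open>The finiteness results in contrapositive form exclude unequal sums and
      \<open>Delta e f x = 0\<close>; nonnegativity then improves
      \<open>Delta e f x \<noteq> 0\<close> to \<open>Delta e f x \<ge> 1\<close>.\<close>
    have "infinite Lucas_primes" using all primes_infinite by (simp add: Lucas_primes_eq cong: conj_cong)
    with finite have bal: "sum_list e = sum_list f" and ne: "\<forall>x\<in>jump_region e f. Delta e f x \<noteq> 0" by blast+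
    have "\<forall>x\<in>jump_region e f. Delta e f x \<ge> 1"
    proof
      fix x assume x: "x \<in> jump_region e f"
      then have "Delta e f x \<ge> 0" by (intro Delta_nonneg) (simp add: jump_region_def)
      with ne x show "Delta e f x \<ge> 1" by force
    qed
    then obtain z where "Q n = p ^ alpha p (factorial_ratio_padic p e f) n * z"
      using power_alpha_dvd_Q[OF bal _ p] by (metis dvdE)
    then have "factorial_ratio e f n = of_nat p ^ alpha p (factorial_ratio_padic p e f) n * of_int (int z)"
      by (simp flip: of_nat_Q)
    then show ?thesis by blast
  qed
  with finite show ?thesis
    using Lucas_congruence p_Lucas_iff by (auto simp: Lucas_primes_eq)
qed

end
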